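(* Let $X$ be a Hausdorff locally convex topological vector space and let $T=\{T_t\}_{t\in\mathbb{R}^+}$ be a $C_0$-sequentially equicontinuous semigroup on $X$ with infinitesimal generator $A$. Assume that for every $x\in X$ and every $\lambda>0$ the generalized Riemann integral $$R(\lambda)x:=\int_0^{+\infty}e^{-\lambda t}T_tx\,dt$$ exists in $X$. If $\lambda>0$, then $\lambda\in\rho_0(A)$ and $R(\lambda,A)=R(\lambda)$.
   Context: $\mathbb{R}^+=[0,+\infty)$. A map between topological spaces is sequentially continuous if it maps convergent sequences to convergent sequences with the corresponding limit. A family $\{f_\iota:X\to X\}_{\iota\in\mathcal{I}}$ is sequentially equicontinuous if for every $x\in X$, every sequence $x_n\to x$ in $X$ and every neighborhood $U$ of $0$ in $X$ there is $\overline n$ such that $f_\iota(x_n)\in f_\iota(x)+U$ for all $\iota\in\mathcal{I}$ and $n\ge\overline n$. A $C_0$-sequentially equicontinuous semigroup on $X$ is a family $T=\{T_t:X\to X\}_{t\in\mathbb{R}^+}$ of linear operators (not assumed continuous) such that: (i) $T_0=I$ and $T_{t+s}=T_tT_s$ for all $t,s\ge0$; (ii) $\lim_{t\to0^+}T_tx=x$ for every $x\in X$; (iii) $T$ is a sequentially equicontinuous family. The infinitesimal generator $A$ of $T$ has domain $\mathcal{D}(A)=\{x\in X:\ \lim_{h\to0^+}\frac{T_hx-x}{h}\text{ exists in }X\}$ and $Ax=\lim_{h\to0^+}\frac{T_hx-x}{h}$ for $x\in\mathcal{D}(A)$. The generalized Riemann integral exists in $X$ if for every $a\ge0$ the Riemann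 integral $\int_0^ae^{-\lambda t}T_tx\,dt$ exists in $X$ and its limit as $a\to+\infty$ exists in $X$. For a linear operator $C:\mathcal{D}(C)\subset X\to X$, the spectrum $\sigma_0(C)$ is the set of $\lambda\in\mathbb{R}$ such that one of the following holds: $\lambda-C$ is not one-to-one; $\operatorname{Im}(\lambda-C)\ne X$; $(\lambda-C)^{-1}$ exists but is not sequentially continuous. The resolvent set is $\rho_0(C)=\mathbb{R}\setminus\sigma_0(C)$, and for $\lambda\in\rho_0(C)$, $R(\lambda,C)=(\lambda-C)^{-1}$. *)

theory Defs
  imports "HOL-Analysis.Analysis"
begin

section \<open>Hausdorff locally convex topological vector spaces over the reals\<close>

text \<open>
  The constant \<open>convex\<close> cannot occur in a class specification, so the assumption below spells out
  its definition; \<open>locally_convex\<close> is the usual form.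
\<close>

class locally_convex_t2 = real_vector + topological_ab_group_add + t2_space +
  assumes tendsto_scaleR_Pair:
      "LIM p (nhds r \<times>\<^sub>F nhds x). fst p *\<^sub>R snd p :> nhds (r *\<^sub>R x)"
    and locally_convex_raw:
      "open U \<Longrightarrow> 0 \<in> U \<Longrightarrow> \<exists>V. open V \<and> 0 \<in> V \<and> V \<subseteq> U \<and>
        (\<forall>x\<in>V. \<forall>y\<in>V. \<forall>u\<ge>0. \<forall>v\<ge>0. u + v = 1 \<longrightarrow> u *\<^sub>R x + v *\<^sub>R y \<in> V)"

lemma locally_convex:
  fixes U :: "'a::locally_convex_t2 set"
  assumes "open U" "0 \<in> U"
  shows "\<exists>V. open V \<and> convex V \<and> 0 \<in> V \<and> V \<subseteq> U"
  using locally_convex_raw[OF assms] unfolding convex_def by blast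


section \<open>Sequential continuity and equicontinuity\<close>

definition seq_continuous_on :: "'a::topological_space set \<Rightarrow> ('a \<Rightarrow> 'b::topological_space) \<Rightarrow> bool"
  where "seq_continuous_on S f \<longleftrightarrow>
    (\<forall>u. \<forall>x\<in>S. (\<forall>n. u n \<in> S) \<longrightarrow> u \<longlonglongrightarrow> x \<longrightarrow> (\<lambda>n. f (u n)) \<longlonglongrightarrow> f x)"

definition seq_equicontinuous :: "'i set \<Rightarrow> ('i \<Rightarrow> 'a::locally_convex_t2 \<Rightarrow> 'a) \<Rightarrow> bool"
  where "seq_equicontinuous I f \<longleftrightarrow>
    (\<forall>x u U. u \<longlonglongrightarrow> x \<longrightarrow> 0 \<in> interior U \<longrightarrow>
      (\<exists>N::nat. \<forall>i\<in>I. \<forall>n\<ge>N. f i (u n) \<in> (\<lambda>z. f i x + z) ` U))"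


section \<open>Semigroups and their generators\<close>

text \<open>The time set is the half-line \<open>{0..}\<close>; values of \<open>T\<close> at negative times are never used.\<close>

definition C0_seq_equicontinuous_semigroup :: "(real \<Rightarrow> 'a::locally_convex_t2 \<Rightarrow> 'a) \<Rightarrow> bool"
  where "C0_seq_equicontinuous_semigroup T \<longleftrightarrow>
    (\<forall>t\<ge>0. linear (T t)) \<and>
    T 0 = id \<and> (\<forall>t\<ge>0. \<forall>s\<ge>0. T (t + s) = T t \<circ> T s) \<and>
    (\<forall>x. ((\<lambda>t. T t x) \<longlongrightarrow> x) (at_right 0)) \<and>
    seq_equicontinuous {0..} T"

definition generator_domain :: "(real \<Rightarrow> 'a::locally_convex_t2 \<Rightarrow> 'a) \<Rightarrow> 'a set"
  where "generator_domain T =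
    {x. \<exists>y. ((\<lambda>h. (1 / h) *\<^sub>R (T h x - x)) \<longlongrightarrow> y) (at_right 0)}"

text \<open>Meaningful only on \<open>generator_domain T\<close>.\<close>

definition generator :: "(real \<Rightarrow> 'a::locally_convex_t2 \<Rightarrow> 'a) \<Rightarrow> 'a \<Rightarrow> 'a"
  where "generator T x = Lim (at_right 0) (\<lambda>h. (1 / h) *\<^sub>R (T h x - x))"


section \<open>Riemann integrals\<close>

text \<open>
  The integral is the limit of Riemann sums as the mesh tends to \<open>0\<close>. Members of a tagged division
  of \<open>{a..b}\<close> are pairs of a tag and a compact interval, whose length is its Lebesgue measure.
\<close>

definition has_riemann_integral :: "(real \<Rightarrow> 'a::locally_convex_t2) \<Rightarrow> 'a \<Rightarrow> real \<Rightarrow> real \<Rightarrow> bool"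
  where "has_riemann_integral f y a b \<longleftrightarrow>
    (\<forall>U. open U \<longrightarrow> y \<in> U \<longrightarrow>
      (\<exists>\<delta>>0. \<forall>p. p tagged_division_of {a..b} \<longrightarrow> (\<forall>(s, K)\<in>p. measure lborel K < \<delta>) \<longrightarrow>
        (\<Sum>(s, K)\<in>p. measure lborel K *\<^sub>R f s) \<in> U))"

definition riemann_integrable :: "(real \<Rightarrow> 'a::locally_convex_t2) \<Rightarrow> real \<Rightarrow> real \<Rightarrow> bool"
  where "riemann_integrable f a b \<longleftrightarrow> (\<exists>y. has_riemann_integral f y a b)"

definition riemann_integral :: "(real \<Rightarrow> 'a::locally_convex_t2) \<Rightarrow> real \<Rightarrow> real \<Rightarrow> 'a"
  where "riemann_integral f a b = (THE y. has_riemann_integral f y a b)"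

definition gen_riemann_integrable :: "(real \<Rightarrow> 'a::locally_convex_t2) \<Rightarrow> bool"
  where "gen_riemann_integrable f \<longleftrightarrow>
    (\<forall>a\<ge>0. riemann_integrable f 0 a) \<and> (\<exists>y. ((\<lambda>a. riemann_integral f 0 a) \<longlongrightarrow> y) at_top)"

definition gen_riemann_integral :: "(real \<Rightarrow> 'a::locally_convex_t2) \<Rightarrow> 'a"
  where "gen_riemann_integral f = Lim at_top (\<lambda>a. riemann_integral f 0 a)"

definition laplace_transform :: "(real \<Rightarrow> 'a::locally_convex_t2 \<Rightarrow> 'a) \<Rightarrow> real \<Rightarrow> 'a \<Rightarrow> 'a"
  where "laplace_transform T \<mu> x = gen_riemann_integral (\<lambda>t. exp (- \<mu> * t) *\<^sub>R T t x)"


section \<open>Spectrum and resolvent\<close>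

text \<open>
  A partially defined operator is a pair of its domain \<open>D\<close> and a function \<open>C\<close> whose values outside
  \<open>D\<close> are irrelevant. The inverse of \<open>\<mu> - C\<close> is defined on the image of \<open>D\<close> under \<open>\<mu> - C\<close>.
\<close>

definition resolvent_op :: "real \<Rightarrow> 'a::locally_convex_t2 set \<Rightarrow> ('a \<Rightarrow> 'a) \<Rightarrow> 'a \<Rightarrow> 'a"
  where "resolvent_op \<mu> D C = the_inv_into D (\<lambda>x. \<mu> *\<^sub>R x - C x)"

definition spectrum\<^sub>0 :: "'a::locally_convex_t2 set \<Rightarrow> ('a \<Rightarrow> 'a) \<Rightarrow> real set"
  where "spectrum\<^sub>0 D C = {\<mu>.
    \<not> inj_on (\<lambda>x. \<mu> *\<^sub>R x - C x) D \<or>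
    (\<lambda>x. \<mu> *\<^sub>R x - C x) ` D \<noteq> UNIV \<or>
    (inj_on (\<lambda>x. \<mu> *\<^sub>R x - C x) D \<and>
      \<not> seq_continuous_on ((\<lambda>x. \<mu> *\<^sub>R x - C x) ` D) (resolvent_op \<mu> D C))}"

definition resolvent_set\<^sub>0 :: "'a::locally_convex_t2 set \<Rightarrow> ('a \<Rightarrow> 'a) \<Rightarrow> real set"
  where "resolvent_set\<^sub>0 D C = - spectrum\<^sub>0 D C"

end

theory Submission
  imports Defs
begin

text \<open>
  Write \<open>R x\<close> for the Laplace transform of the orbit of \<open>x\<close> and \<open>I\<^sub>a x\<close> for its truncation to
  \<open>{0..a}\<close>. Everything rests on the identity
  \<open>R x = I\<^sub>h x + exp (- \<mu> * h) *\<^sub>R T h (R x)\<close> for \<open>h > 0\<close>, which splits the integral at \<open>h\<close> and uses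
  the semigroup law on the tail. Solving for \<open>T h (R x)\<close> and dividing by \<open>h\<close> gives
  \<open>(T h (R x) - R x) / h = ((exp (\<mu> * h) - 1) / h) *\<^sub>R R x - exp (\<mu> * h) *\<^sub>R (I\<^sub>h x / h)\<close>,
  and as \<open>I\<^sub>h x / h\<close> tends to \<open>x\<close>, the vector \<open>R x\<close> lies in the domain of the generator \<open>A\<close> with
  \<open>A (R x) = \<mu> *\<^sub>R R x - x\<close>: thus \<open>R\<close> is a right inverse of \<open>\<mu> - A\<close>
  (\<open>generator_quotient_laplace\<close>). It is also a left inverse, because \<open>R\<close> is
  linear, commutes with every \<open>T h\<close> and is sequentially continuous, so that it can be moved through
  the limit that defines \<open>A x\<close>.

  The space may be incomplete and the operators are only sequentially continuous. Integrals are
  therefore only ever accessed through one explicit sequence of Riemann sums over equidistant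
  divisions. Sequential continuity is then enough to carry \<open>T h\<close> through an integral
  (\<open>semigroup_integral\<close>), and every estimate is a
  statement about finite convex combinations followed by a passage to a closed set. Sequential
  continuity of \<open>R\<close> is such an estimate: the
  weights \<open>exp (- \<mu> * t)\<close> have total mass at most \<open>1 / \<mu>\<close>, so a convex neighbourhood of \<open>0\<close>
  containing all the differences \<open>T t (u n) - T t x\<close> also contains, up to closure and the factor
  \<open>1 / \<mu>\<close>, the difference \<open>R (u n) - R x\<close> (\<open>laplace_mem_closure\<close>).
\<close>


section \<open>Locally convex spaces\<close>

lemma tendsto_scaleR_locally_convex:
  fixes g :: "'b \<Rightarrow> 'a::locally_convex_t2"
  assumes "(f \<longlongrightarrow> r) F" "(g \<longlongrightarrow> x) F"
  shows "((\<lambda>i. f i *\<^sub>R g i) \<longlongrightarrow> r *\<^sub>R x) F"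
  using filterlim_compose[OF tendsto_scaleR_Pair filterlim_Pair[OF assms]] by simp

lemma convex_neighbourhood_closure:
  fixes U :: "'a::locally_convex_t2 set"
  assumes "open U" "0 \<in> U"
  shows "\<exists>V. open V \<and> convex V \<and> 0 \<in> V \<and> closure V \<subseteq> U"
proof -
  have "((\<lambda>p::'a \<times> 'a. fst p + snd p) \<longlongrightarrow> 0 + 0) (nhds 0 \<times>\<^sub>F nhds 0)"
    by (intro tendsto_add filterlim_fst filterlim_snd)
  then have "\<forall>\<^sub>F p in nhds 0 \<times>\<^sub>F nhds (0::'a). fst p + snd p \<in> U"
    using assms by (auto dest: topological_tendstoD)
  then obtain P Q where PQ: "eventually P (nhds (0::'a))" "eventually Q (nhds (0::'a))"
    "\<And>x y. P x \<Longrightarrow> Q y \<Longrightarrow> x + y \<in> U"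
    unfolding eventually_prod_filter by auto
  then have "\<forall>\<^sub>F x in nhds (0::'a). P x \<and> Q x"
    by (simp add: eventually_conj)
  then obtain W where W: "open W" "0 \<in> W" "\<And>x. x \<in> W \<Longrightarrow> P x \<and> Q x"
    unfolding eventually_nhds by auto
  obtain V where V: "open V" "convex V" "0 \<in> V" "V \<subseteq> W"
    using locally_convex[OF W(1,2)] by blast
  have "z \<in> U" if z: "z \<in> closure V" for z
  proof -
    have "((\<lambda>w. z - w) \<longlongrightarrow> z - z) (nhds z)"
      by (intro tendsto_diff tendsto_const filterlim_ident)
    then have "\<forall>\<^sub>F w in nhds z. z - w \<in> V"
      using V by (auto dest: topological_tendstoD)
    then obtain N where N: "open N" "z \<in> N" "\<And>w. w \<in> N \<Longrightarrow> z - w \<in> V"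
      unfolding eventually_nhds by auto
    then obtain w where "w \<in> N" "w \<in> V"
      using z open_Int_closure_eq_empty[of N V] by blast
    then have "(z - w) + w \<in> U"
      using N V W PQ by blast
    then show ?thesis by simp
  qed
  then show ?thesis using V by blast
qed

lemma limit_in_closure:
  fixes u :: "nat \<Rightarrow> 'a::topological_space"
  assumes "u \<longlonglongrightarrow> x" "\<And>n. u n \<in> V"
  shows "x \<in> closure V"
  using assms closure_subset[of V]
  by (intro Lim_in_closed_set[OF closed_closure always_eventually _ assms(1)]) auto

text \<open>The missing mass is put on \<open>0\<close>.\<close>

lemma convex_subcombination:
  fixes V :: "'a::real_vector set" and n :: nat
  assumes "convex V" "0 \<in> V" "\<And>i. i < n \<Longrightarrow> 0 \<le> c i" "(\<Sum>i<n. c i) \<le> 1"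
    "\<And>i. i < n \<Longrightarrow> y i \<in> V"
  shows "(\<Sum>i<n. c i *\<^sub>R y i) \<in> V"
proof -
  define c' where "c' i = (if i < n then c i else 1 - (\<Sum>i<n. c i))" for i
  define y' where "y' i = (if i < n then y i else 0)" for i
  have "(\<Sum>i<Suc n. c' i) = 1"
    by (simp add: c'_def)
  then have "(\<Sum>i<Suc n. c' i *\<^sub>R y' i) \<in> V"
    using assms by (intro convex_sum) (auto simp: c'_def y'_def)
  then show ?thesis
    by (simp add: c'_def y'_def)
qed


section \<open>Equidistant Riemann sums\<close>

text \<open>
  Tags are right endpoints, so that the sums of a decreasing function stay below its integral; the
  index is shifted so that the number of intervals is never zero.
\<close>

definition equi_division :: "real \<Rightarrow> real \<Rightarrow> nat \<Rightarrow> (real \<times> real set) set"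
  where "equi_division a b n =
    (\<lambda>i. (a + real (Suc i) * ((b - a) / Suc n),
          {a + real i * ((b - a) / Suc n)..a + real (Suc i) * ((b - a) / Suc n)})) ` {..<Suc n}"

definition equi_sum :: "(real \<Rightarrow> 'a::real_vector) \<Rightarrow> real \<Rightarrow> real \<Rightarrow> nat \<Rightarrow> 'a"
  where "equi_sum f a b n =
    (\<Sum>i<Suc n. ((b - a) / Suc n) *\<^sub>R f (a + real (Suc i) * ((b - a) / Suc n)))"

lemma equi_division_tagged:
  assumes "a < b"
  shows "equi_division a b n tagged_division_of {a..b}"
proof -
  define d where "d = (b - a) / Suc n"
  have d: "d > 0" "a + real (Suc n) * d = b"
    using assms by (auto simp: d_def)
  have le: "a + real i * d \<le> a + real j * d" if "i \<le> j" for i j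
    using that d by simp
  have le_b: "a + real (Suc i) * d \<le> b" if "i < Suc n" for i
    using le[of "Suc i" "Suc n", unfolded d(2)] that by simp
  have disj: "interior {a + real i * d..a + real (Suc i) * d} \<inter>
      interior {a + real j * d..a + real (Suc j) * d} = {}" if "i < j" for i j
  proof -
    have "a + real (Suc i) * d \<le> a + real j * d"
      using that le[of "Suc i" j] by simp
    then show ?thesis by auto
  qed
  have cover: "\<exists>i<Suc n. a + real i * d \<le> x \<and> x \<le> a + real (Suc i) * d"
    if "a \<le> x" "x \<le> b" for x
  proof (cases "x = a")
    case True
    then show ?thesis using d by (intro exI[of _ 0]) auto
  next
    case False
    then have pos: "0 < (x - a) / d" using that d by simp
    define k where "k = nat (\<lceil>(x - a) / d\<rceil> - 1)"
    have k1: "real k < (x - a) / d" "(x - a) / d \<le> real (Suc k)"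
      using pos unfolding k_def by linarith+
    then have k2: "a + real k * d < x" "x \<le> a + real (Suc k) * d"
      using d(1) by (auto simp: field_simps)
    have "real k * d < real (Suc n) * d"
      using k2(1) d(2) that by linarith
    then have "k < Suc n" using d(1) by simp
    then show ?thesis using k2 by auto
  qed
  show ?thesis
    unfolding tagged_division_of equi_division_def d_def[symmetric]
  proof (intro conjI allI impI)
    fix x K assume "(x, K) \<in> (\<lambda>i. (a + real (Suc i) * d,
      {a + real i * d..a + real (Suc i) * d})) ` {..<Suc n}"
    then obtain i where i: "i < Suc n" "x = a + real (Suc i) * d"
      "K = {a + real i * d..a + real (Suc i) * d}" by auto
    show "x \<in> K" using i d by auto
    show "K \<subseteq> {a..b}" using i le_b[OF i(1)] d le[of 0 i] by auto
    show "\<exists>a b. K = cbox a b" using i by auto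
  next
    fix x1 K1 x2 K2
    assume A: "(x1, K1) \<in> (\<lambda>i. (a + real (Suc i) * d,
      {a + real i * d..a + real (Suc i) * d})) ` {..<Suc n} \<and>
      (x2, K2) \<in> (\<lambda>i. (a + real (Suc i) * d,
      {a + real i * d..a + real (Suc i) * d})) ` {..<Suc n} \<and> (x1, K1) \<noteq> (x2, K2)"
    obtain i where i: "x1 = a + real (Suc i) * d" "K1 = {a + real i * d..a + real (Suc i) * d}"
      using A by auto
    obtain j where j: "x2 = a + real (Suc j) * d" "K2 = {a + real j * d..a + real (Suc j) * d}"
      using A by auto
    have "i \<noteq> j" using A i j by auto
    then show "interior K1 \<inter> interior K2 = {}"
      using disj[of i j] disj[of j i] unfolding i j by (metis Int_commute linorder_neqE_nat)
  next
    show "\<Union> {K. \<exists>x. (x, K) \<in> (\<lambda>i. (a + real (Suc i) * d,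
        {a + real i * d..a + real (Suc i) * d})) ` {..<Suc n}} = {a..b}" (is "?L = _")
    proof
      show "?L \<subseteq> {a..b}"
      proof
        fix x assume "x \<in> ?L"
        then obtain i where i: "i < Suc n" "a + real i * d \<le> x" "x \<le> a + real (Suc i) * d"
          by auto
        then show "x \<in> {a..b}"
          using le_b[OF i(1)] le[of 0 i] by auto
      qed
      show "{a..b} \<subseteq> ?L"
      proof
        fix x assume "x \<in> {a..b}"
        then obtain i where "i < Suc n" "a + real i * d \<le> x" "x \<le> a + real (Suc i) * d"
          using cover[of x] by auto
        then show "x \<in> ?L"
          by (intro UnionI[of "{a + real i * d..a + real (Suc i) * d}"]) auto
      qed
    qed
  qed simp
qed

lemma equi_division_measure:
  assumes "a < b" "(s, K) \<in> equi_division a b n"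
  shows "measure lborel K = (b - a) / Suc n"
proof -
  define d where "d = (b - a) / Suc n"
  have "d > 0" using assms(1) by (simp add: d_def)
  moreover obtain i where "K = {a + real i * d..a + real (Suc i) * d}"
    using assms(2) by (auto simp: equi_division_def d_def)
  ultimately have "measure lborel K = d" by (simp add: algebra_simps)
  then show ?thesis by (simp only: d_def)
qed

lemma sum_equi_division:
  assumes "a < b"
  shows "(\<Sum>(s, K)\<in>equi_division a b n. measure lborel K *\<^sub>R f s) = equi_sum f a b n"
proof -
  have inj: "inj_on (\<lambda>i. (a + real (Suc i) * ((b - a) / Suc n),
      {a + real i * ((b - a) / Suc n)..a + real (Suc i) * ((b - a) / Suc n)})) {..<Suc n}"
    using assms by (auto simp: inj_on_def)
  have "(\<Sum>(s, K)\<in>equi_division a b n. measure lborel K *\<^sub>R f s) =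
      (\<Sum>(s, K)\<in>equi_division a b n. ((b - a) / Suc n) *\<^sub>R f s)"
    using equi_division_measure[OF assms] by (intro sum.cong) auto
  also have "\<dots> = equi_sum f a b n"
    unfolding equi_division_def equi_sum_def by (subst sum.reindex[OF inj]) simp
  finally show ?thesis .
qed

lemma eventually_mesh_less:
  fixes c \<delta> :: real
  assumes "\<delta> > 0"
  shows "\<forall>\<^sub>F n in sequentially. c / real (Suc n) < \<delta>"
proof -
  have "(\<lambda>n. c / real (Suc n)) \<longlonglongrightarrow> 0"
    using LIMSEQ_Suc[OF lim_const_over_n[of c]] by simp
  then show ?thesis using assms by (rule order_tendstoD)
qed

lemma equi_sum_tendsto:
  assumes "has_riemann_integral f y a b" "a < b"
  shows "equi_sum f a b \<longlonglongrightarrow> y"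
proof (rule topological_tendstoI)
  fix U assume "open U" "y \<in> U"
  then obtain \<delta> where \<delta>: "\<delta> > 0" and
    U: "\<And>p. p tagged_division_of {a..b} \<Longrightarrow> (\<forall>(s, K)\<in>p. measure lborel K < \<delta>) \<Longrightarrow>
        (\<Sum>(s, K)\<in>p. measure lborel K *\<^sub>R f s) \<in> U"
    using assms(1) unfolding has_riemann_integral_def by blast
  show "\<forall>\<^sub>F n in sequentially. equi_sum f a b n \<in> U"
    using eventually_mesh_less[OF \<delta>, of "b - a"]
  proof eventually_elim
    case (elim n)
    have "\<forall>(s, K)\<in>equi_division a b n. measure lborel K < \<delta>"
      using elim equi_division_measure[OF assms(2)] by auto
    from U[OF equi_division_tagged[OF assms(2)] this] show ?case
      by (simp only: sum_equi_division[OF assms(2)])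
  qed
qed

lemma riemann_integral_unique:
  assumes "has_riemann_integral f y a b" "a < b"
  shows "riemann_integral f a b = y"
  unfolding riemann_integral_def
  using assms equi_sum_tendsto[OF _ assms(2), of f] LIMSEQ_unique by blast

lemma equi_sum_tendsto_riemann_integral:
  assumes "riemann_integrable f a b" "a < b"
  shows "equi_sum f a b \<longlonglongrightarrow> riemann_integral f a b"
  using assms equi_sum_tendsto riemann_integral_unique unfolding riemann_integrable_def by metis

text \<open>
  The juxtaposition of the two equidistant divisions with the same number of members is not
  equidistant unless \<open>b\<close> is the midpoint, but it is still a division of small mesh.
\<close>

lemma equi_sum_concat_tendsto:
  assumes "riemann_integrable f a c" "a < b" "b < c"
  shows "(\<lambda>n. equi_sum f a b n + equi_sum f b c n) \<longlonglongrightarrow> riemann_integral f a c"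
proof (rule topological_tendstoI)
  fix U assume U: "open U" "riemann_integral f a c \<in> U"
  obtain y where y: "has_riemann_integral f y a c"
    using assms(1) unfolding riemann_integrable_def by blast
  then have "y \<in> U"
    using U(2) riemann_integral_unique[of f y a c] assms by simp
  then obtain \<delta> where \<delta>: "\<delta> > 0" and
    sums: "\<And>p. p tagged_division_of {a..c} \<Longrightarrow> (\<forall>(s, K)\<in>p. measure lborel K < \<delta>) \<Longrightarrow>
        (\<Sum>(s, K)\<in>p. measure lborel K *\<^sub>R f s) \<in> U"
    using y U(1) unfolding has_riemann_integral_def by blast
  show "\<forall>\<^sub>F n in sequentially. equi_sum f a b n + equi_sum f b c n \<in> U"
    using eventually_mesh_less[OF \<delta>, of "b - a"] eventually_mesh_less[OF \<delta>, of "c - b"]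
  proof eventually_elim
    case (elim n)
    let ?p = "equi_division a b n" and ?q = "equi_division b c n"
    have p: "?p tagged_division_of {a..b}" and q: "?q tagged_division_of {b..c}"
      using equi_division_tagged assms by auto
    have "?p \<union> ?q tagged_division_of {a..b} \<union> {b..c}"
      by (rule tagged_division_Un[OF p q]) auto
    then have div: "?p \<union> ?q tagged_division_of {a..c}"
      using assms by (simp add: ivl_disj_un)
    have "?p \<inter> ?q = {}"
    proof (rule ccontr)
      assume "?p \<inter> ?q \<noteq> {}"
      then obtain s K where sK: "(s, K) \<in> ?p" "(s, K) \<in> ?q" by auto
      \<comment> \<open>A common member would lie in \<open>{b}\<close>, although the members are not degenerate.\<close>
      have "K \<subseteq> {b}"
        using tagged_division_ofD(3)[OF p sK(1)] tagged_division_ofD(3)[OF q sK(2)] by force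
      moreover have "K \<noteq> {}"
        using tagged_division_ofD(2)[OF p sK(1)] by auto
      ultimately have "K = {b}" by blast
      then show False
        using equi_division_measure[OF assms(2) sK(1)] assms(2) by auto
    qed
    then have "(\<Sum>(s, K)\<in>?p \<union> ?q. measure lborel K *\<^sub>R f s) =
        equi_sum f a b n + equi_sum f b c n"
      using p q assms by (subst sum.union_disjoint) (auto simp: sum_equi_division)
    moreover have "\<forall>(s, K)\<in>?p \<union> ?q. measure lborel K < \<delta>"
      using elim equi_division_measure assms by auto
    ultimately show ?case using sums[OF div] by metis
  qed
qed

text \<open>
  Divided by \<open>b - a\<close>, an equidistant sum is a convex combination of values of \<open>f\<close>. The closure is
  the price of passing to the limit.
\<close>

lemma mean_mem_closure:
  assumes "riemann_integrable f a b" "a < b" "convex V"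
    "\<And>t. a \<le> t \<Longrightarrow> t \<le> b \<Longrightarrow> f t - x \<in> V"
  shows "(1 / (b - a)) *\<^sub>R riemann_integral f a b - x \<in> closure V"
proof -
  have mem: "(1 / (b - a)) *\<^sub>R equi_sum f a b n - x \<in> V" for n
  proof -
    have "(1 / (b - a)) *\<^sub>R equi_sum f a b n - x =
        (\<Sum>i<Suc n. (1 / Suc n) *\<^sub>R (f (a + real (Suc i) * ((b - a) / Suc n)) - x))"
      using assms(2)
      by (simp add: equi_sum_def scaleR_sum_right scaleR_diff_right sum_subtractf
          sum_constant_scaleR del: sum.lessThan_Suc of_nat_Suc)
    also have "\<dots> \<in> V"
    proof (rule convex_sum)
      fix i assume "i \<in> {..<Suc n}"
      then have "real (Suc i) * ((b - a) / Suc n) \<le> real (Suc n) * ((b - a) / Suc n)"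
        using assms(2) by (intro mult_right_mono) auto
      then have "real (Suc i) * ((b - a) / Suc n) \<le> b - a" by simp
      moreover have "0 \<le> real (Suc i) * ((b - a) / Suc n)" using assms(2) by simp
      ultimately show "f (a + real (Suc i) * ((b - a) / Suc n)) - x \<in> V"
        by (intro assms(4)) linarith+
    qed (use assms in \<open>auto simp del: sum.lessThan_Suc of_nat_Suc\<close>)
    finally show ?thesis .
  qed
  have "(\<lambda>n. (1 / (b - a)) *\<^sub>R equi_sum f a b n - x)
      \<longlonglongrightarrow> (1 / (b - a)) *\<^sub>R riemann_integral f a b - x"
    by (intro tendsto_diff tendsto_scaleR_locally_convex tendsto_const
        equi_sum_tendsto_riemann_integral assms)
  then show ?thesis
    using mem by (rule limit_in_closure)
qed

text \<open>
  The whole geometric series with ratio \<open>exp (- x)\<close>, started at exponent one, sums to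
  \<open>1 / (exp x - 1)\<close>, which is at most \<open>1 / x\<close>.
\<close>

lemma exp_right_sum_le:
  fixes x :: real
  assumes "x > 0"
  shows "(\<Sum>i<n. x * exp (- (real (Suc i) * x))) \<le> 1"
proof -
  have "(exp x - 1) * (\<Sum>i<n. exp (- (real (Suc i) * x))) = 1 - exp (- (real n * x))"
    by (induction n) (simp_all add: algebra_simps exp_add[symmetric])
  moreover have "x \<le> exp x - 1"
    using exp_ge_add_one_self[of x] by linarith
  then have "x * (\<Sum>i<n. exp (- (real (Suc i) * x)))
      \<le> (exp x - 1) * (\<Sum>i<n. exp (- (real (Suc i) * x)))"
    by (intro mult_right_mono sum_nonneg) auto
  ultimately show ?thesis
    unfolding sum_distrib_left[symmetric] using exp_gt_zero[of "- (real n * x)"] by linarith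
qed


section \<open>The Laplace transform of a semigroup\<close>

locale laplace_semigroup =
  fixes T :: "real \<Rightarrow> 'a::locally_convex_t2 \<Rightarrow> 'a" and \<mu> :: real
  assumes semigroup: "C0_seq_equicontinuous_semigroup T"
    and integrable: "gen_riemann_integrable (\<lambda>t. exp (- \<mu> * t) *\<^sub>R T t x)"
    and pos: "\<mu> > 0"
begin

definition truncated :: "real \<Rightarrow> 'a \<Rightarrow> 'a"
  where "truncated a x = riemann_integral (\<lambda>t. exp (- \<mu> * t) *\<^sub>R T t x) 0 a"

lemma linear_T: "t \<ge> 0 \<Longrightarrow> linear (T t)"
  and T_0: "T 0 x = x"
  and T_add: "t \<ge> 0 \<Longrightarrow> s \<ge> 0 \<Longrightarrow> T (t + s) x = T t (T s x)"
  and T_tendsto: "((\<lambda>t. T t x) \<longlongrightarrow> x) (at_right 0)"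
  using semigroup unfolding C0_seq_equicontinuous_semigroup_def by auto

lemma equicontinuous:
  assumes "u \<longlonglongrightarrow> x" "open U" "0 \<in> U"
  shows "\<forall>\<^sub>F n in sequentially. \<forall>t\<ge>0. T t (u n) - T t x \<in> U"
proof -
  have "0 \<in> interior U" using assms by (simp add: interior_open)
  then obtain N where N: "\<And>t n. t \<in> {0..} \<Longrightarrow> n \<ge> N \<Longrightarrow> T t (u n) \<in> (\<lambda>z. T t x + z) ` U"
    using semigroup assms(1)
    unfolding C0_seq_equicontinuous_semigroup_def seq_equicontinuous_def by meson
  have "T t (u n) - T t x \<in> U" if "t \<ge> 0" "n \<ge> N" for t n
    using N[of t n] that by auto
  then show ?thesis
    unfolding eventually_sequentially by blast
qed

lemma T_seq_tendsto:
  assumes "u \<longlonglongrightarrow> x" "t \<ge> 0"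
  shows "(\<lambda>n. T t (u n)) \<longlonglongrightarrow> T t x"
proof -
  have "(\<lambda>n. T t (u n) - T t x) \<longlonglongrightarrow> 0"
  proof (rule topological_tendstoI)
    fix U :: "'a set" assume "open U" "0 \<in> U"
    from equicontinuous[OF assms(1) this] show "\<forall>\<^sub>F n in sequentially. T t (u n) - T t x \<in> U"
      by eventually_elim (use assms in auto)
  qed
  from tendsto_add[OF this tendsto_const[of "T t x"]] show ?thesis by simp
qed

lemma integrable_truncated:
  "a \<ge> 0 \<Longrightarrow> riemann_integrable (\<lambda>t. exp (- \<mu> * t) *\<^sub>R T t x) 0 a"
  using integrable[of x] unfolding gen_riemann_integrable_def by blast

lemma truncated_sums:
  assumes "a > 0"
  shows "equi_sum (\<lambda>t. exp (- \<mu> * t) *\<^sub>R T t x) 0 a \<longlonglongrightarrow> truncated a x"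
  unfolding truncated_def
  using equi_sum_tendsto_riemann_integral[OF integrable_truncated] assms by simp

lemma truncated_tendsto: "((\<lambda>a. truncated a x) \<longlongrightarrow> laplace_transform T \<mu> x) at_top"
proof -
  obtain y where y: "((\<lambda>a. truncated a x) \<longlongrightarrow> y) at_top"
    using integrable[of x] unfolding gen_riemann_integrable_def truncated_def by blast
  then have "laplace_transform T \<mu> x = y"
    unfolding laplace_transform_def gen_riemann_integral_def truncated_def[symmetric]
    by (intro tendsto_Lim) auto
  with y show ?thesis by simp
qed

lemma truncated_seq_tendsto: "(\<lambda>n. truncated (real (Suc n)) x) \<longlonglongrightarrow> laplace_transform T \<mu> x"
  using filterlim_compose[OF truncated_tendsto filterlim_compose[OF filterlim_real_sequentially
        filterlim_Suc]] .

subsection \<open>Linearity, commutation and the splitting identity\<close>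

lemma laplace_scaleR: "laplace_transform T \<mu> (c *\<^sub>R x) = c *\<^sub>R laplace_transform T \<mu> x"
proof -
  have "truncated a (c *\<^sub>R x) = c *\<^sub>R truncated a x" if "a > 0" for a
  proof (rule LIMSEQ_unique[OF truncated_sums[OF that]])
    have "equi_sum (\<lambda>t. exp (- \<mu> * t) *\<^sub>R T t (c *\<^sub>R x)) 0 a =
        (\<lambda>n. c *\<^sub>R equi_sum (\<lambda>t. exp (- \<mu> * t) *\<^sub>R T t x) 0 a n)"
      using that by (simp add: fun_eq_iff equi_sum_def scaleR_sum_right
          linear_cmul[OF linear_T] mult_ac del: sum.lessThan_Suc of_nat_Suc)
    then show "equi_sum (\<lambda>t. exp (- \<mu> * t) *\<^sub>R T t (c *\<^sub>R x)) 0 a \<longlonglongrightarrow> c *\<^sub>R truncated a x"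
      using tendsto_scaleR_locally_convex[OF tendsto_const truncated_sums[OF that]] by simp
  qed
  then have "(\<lambda>n. c *\<^sub>R truncated (real (Suc n)) x) \<longlonglongrightarrow> laplace_transform T \<mu> (c *\<^sub>R x)"
    using truncated_seq_tendsto[of "c *\<^sub>R x"] by simp
  then show ?thesis
    using LIMSEQ_unique
      tendsto_scaleR_locally_convex[OF tendsto_const truncated_seq_tendsto] by blast
qed

lemma laplace_diff:
  "laplace_transform T \<mu> (x - y) = laplace_transform T \<mu> x - laplace_transform T \<mu> y"
proof -
  have "truncated a (x - y) = truncated a x - truncated a y" if "a > 0" for a
  proof (rule LIMSEQ_unique[OF truncated_sums[OF that]])
    have "equi_sum (\<lambda>t. exp (- \<mu> * t) *\<^sub>R T t (x - y)) 0 a =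
        (\<lambda>n. equi_sum (\<lambda>t. exp (- \<mu> * t) *\<^sub>R T t x) 0 a n -
             equi_sum (\<lambda>t. exp (- \<mu> * t) *\<^sub>R T t y) 0 a n)"
      using that by (simp add: fun_eq_iff equi_sum_def sum_subtractf scaleR_diff_right
          linear_diff[OF linear_T] del: sum.lessThan_Suc of_nat_Suc)
    then show "equi_sum (\<lambda>t. exp (- \<mu> * t) *\<^sub>R T t (x - y)) 0 a
        \<longlonglongrightarrow> truncated a x - truncated a y"
      using tendsto_diff[OF truncated_sums[OF that] truncated_sums[OF that]] by simp
  qed
  then have "(\<lambda>n. truncated (real (Suc n)) x - truncated (real (Suc n)) y)
      \<longlonglongrightarrow> laplace_transform T \<mu> (x - y)"
    using truncated_seq_tendsto[of "x - y"] by simp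
  then show ?thesis
    using LIMSEQ_unique tendsto_diff[OF truncated_seq_tendsto truncated_seq_tendsto] by blast
qed

lemma T_equi_sum:
  assumes "h \<ge> 0" "a > 0"
  shows "T h (equi_sum (\<lambda>t. exp (- \<mu> * t) *\<^sub>R T t x) 0 a n) =
    equi_sum (\<lambda>t. exp (- \<mu> * t) *\<^sub>R T (h + t) x) 0 a n"
  using assms by (simp add: equi_sum_def linear_sum[OF linear_T] linear_cmul[OF linear_T] T_add
      del: sum.lessThan_Suc of_nat_Suc)

text \<open>
  The sums approach the integral along a sequence, which is why sequential continuity of \<open>T h\<close>
  suffices.
\<close>

lemma semigroup_integral:
  assumes "h \<ge> 0" "a > 0"
  shows "equi_sum (\<lambda>t. exp (- \<mu> * t) *\<^sub>R T (h + t) x) 0 a \<longlonglongrightarrow> T h (truncated a x)"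
  using T_seq_tendsto[OF truncated_sums[OF assms(2)] assms(1), of x]
  unfolding T_equi_sum[OF assms] .

lemma laplace_commutes:
  assumes "h \<ge> 0"
  shows "laplace_transform T \<mu> (T h x) = T h (laplace_transform T \<mu> x)"
proof -
  have "truncated a (T h x) = T h (truncated a x)" if "a > 0" for a
  proof (rule LIMSEQ_unique[OF truncated_sums[OF that]])
    have "equi_sum (\<lambda>t. exp (- \<mu> * t) *\<^sub>R T t (T h x)) 0 a =
        equi_sum (\<lambda>t. exp (- \<mu> * t) *\<^sub>R T (h + t) x) 0 a"
      using that assms by (simp add: fun_eq_iff equi_sum_def T_add[symmetric] add.commute[of h]
          del: sum.lessThan_Suc of_nat_Suc)
    then show "equi_sum (\<lambda>t. exp (- \<mu> * t) *\<^sub>R T t (T h x)) 0 a \<longlonglongrightarrow> T h (truncated a x)"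
      using semigroup_integral[OF assms that] by simp
  qed
  then have "(\<lambda>n. T h (truncated (real (Suc n)) x)) \<longlonglongrightarrow> laplace_transform T \<mu> (T h x)"
    using truncated_seq_tendsto[of "T h x"] by simp
  then show ?thesis
    using LIMSEQ_unique T_seq_tendsto[OF truncated_seq_tendsto assms] by blast
qed

lemma truncated_split:
  assumes "h > 0" "a > 0"
  shows "truncated (h + a) x = truncated h x + exp (- \<mu> * h) *\<^sub>R T h (truncated a x)"
proof (rule LIMSEQ_unique)
  let ?f = "\<lambda>t. exp (- \<mu> * t) *\<^sub>R T t x"
  show "(\<lambda>n. equi_sum ?f 0 h n + equi_sum ?f h (h + a) n) \<longlonglongrightarrow> truncated (h + a) x"
    unfolding truncated_def using assms
    by (intro equi_sum_concat_tendsto integrable_truncated) auto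
  have exp_shift: "exp (- \<mu> * (h + t)) = exp (- \<mu> * h) * exp (- \<mu> * t)" for t
    by (simp add: distrib_left flip: exp_add)
  have "equi_sum ?f h (h + a) =
      (\<lambda>n. exp (- \<mu> * h) *\<^sub>R equi_sum (\<lambda>t. exp (- \<mu> * t) *\<^sub>R T (h + t) x) 0 a n)"
    unfolding equi_sum_def exp_shift scaleR_sum_right
    by (intro ext sum.cong) (simp_all add: mult_ac)
  then have tail: "equi_sum ?f h (h + a) \<longlonglongrightarrow> exp (- \<mu> * h) *\<^sub>R T h (truncated a x)"
    using tendsto_scaleR_locally_convex[OF tendsto_const semigroup_integral[of h a x]] assms
    by (simp only:)
  show "(\<lambda>n. equi_sum ?f 0 h n + equi_sum ?f h (h + a) n)
      \<longlonglongrightarrow> truncated h x + exp (- \<mu> * h) *\<^sub>R T h (truncated a x)"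
    by (rule tendsto_add[OF truncated_sums[OF assms(1)] tail])
qed

lemma laplace_split:
  assumes "h > 0"
  shows "laplace_transform T \<mu> x =
    truncated h x + exp (- \<mu> * h) *\<^sub>R T h (laplace_transform T \<mu> x)"
proof (rule LIMSEQ_unique)
  have "filterlim (\<lambda>n. h + real (Suc n)) at_top sequentially"
    by (intro filterlim_tendsto_add_at_top[OF tendsto_const]
        filterlim_compose[OF filterlim_real_sequentially filterlim_Suc])
  then show "(\<lambda>n. truncated (h + real (Suc n)) x) \<longlonglongrightarrow> laplace_transform T \<mu> x"
    by (rule filterlim_compose[OF truncated_tendsto])
  have "truncated (h + real (Suc n)) x =
      truncated h x + exp (- \<mu> * h) *\<^sub>R T h (truncated (real (Suc n)) x)" for n
    using truncated_split[OF assms] by simp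
  then show "(\<lambda>n. truncated (h + real (Suc n)) x)
      \<longlonglongrightarrow> truncated h x + exp (- \<mu> * h) *\<^sub>R T h (laplace_transform T \<mu> x)"
    using T_seq_tendsto[OF truncated_seq_tendsto, of h x] assms
    by (simp only:) (intro tendsto_add tendsto_scaleR_locally_convex tendsto_const, simp)
qed

subsection \<open>Right inverse\<close>

lemma mean_tendsto: "((\<lambda>h. (1 / h) *\<^sub>R truncated h x) \<longlongrightarrow> x) (at_right 0)"
proof -
  let ?f = "\<lambda>t. exp (- \<mu> * t) *\<^sub>R T t x"
  have "((\<lambda>t. exp (- \<mu> * t)) \<longlongrightarrow> exp (- \<mu> * 0)) (at_right 0)"
    by (intro tendsto_intros)
  then have "(?f \<longlongrightarrow> exp (- \<mu> * 0) *\<^sub>R x) (at_right 0)"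
    by (rule tendsto_scaleR_locally_convex[OF _ T_tendsto])
  from tendsto_diff[OF this tendsto_const[of x]]
  have f: "((\<lambda>t. ?f t - x) \<longlongrightarrow> 0) (at_right 0)" by simp
  have "((\<lambda>h. (1 / h) *\<^sub>R truncated h x - x) \<longlongrightarrow> 0) (at_right 0)"
  proof (rule topological_tendstoI)
    fix U :: "'a set" assume "open U" "0 \<in> U"
    then obtain V where V: "open V" "convex V" "0 \<in> V" "closure V \<subseteq> U"
      using convex_neighbourhood_closure by blast
    obtain b where b: "b > 0" "\<And>t. 0 < t \<Longrightarrow> t < b \<Longrightarrow> ?f t - x \<in> V"
      using topological_tendstoD[OF f V(1,3)] unfolding eventually_at_right_field by auto
    have "(1 / h) *\<^sub>R truncated h x - x \<in> U" if h: "0 < h" "h < b" for h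
    proof -
      have "?f t - x \<in> V" if "0 \<le> t" "t \<le> h" for t
        using b(2)[of t] that h V(3) by (cases "t = 0") (auto simp: T_0)
      from mean_mem_closure[OF integrable_truncated h(1) V(2) this] h V(4) show ?thesis
        by (auto simp: truncated_def)
    qed
    then show "\<forall>\<^sub>F h in at_right 0. (1 / h) *\<^sub>R truncated h x - x \<in> U"
      using b(1) unfolding eventually_at_right_field by blast
  qed
  from tendsto_add[OF this tendsto_const[of x]] show ?thesis by simp
qed

lemma generator_quotient_laplace:
  "((\<lambda>h. (1 / h) *\<^sub>R (T h (laplace_transform T \<mu> x) - laplace_transform T \<mu> x))
    \<longlongrightarrow> \<mu> *\<^sub>R laplace_transform T \<mu> x - x) (at_right 0)"
proof -
  let ?R = "laplace_transform T \<mu> x"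
  have "((\<lambda>h. exp (\<mu> * h)) has_real_derivative \<mu>) (at 0)"
    by (auto intro!: derivative_eq_intros)
  then have slope: "((\<lambda>h. (exp (\<mu> * h) - 1) / h) \<longlongrightarrow> \<mu>) (at_right 0)"
    unfolding DERIV_def by (auto intro: filterlim_at_split[THEN iffD1, THEN conjunct2])
  have "((\<lambda>h. exp (\<mu> * h)) \<longlongrightarrow> exp (\<mu> * 0)) (at_right 0)"
    by (intro tendsto_intros)
  then have "((\<lambda>h. ((exp (\<mu> * h) - 1) / h) *\<^sub>R ?R - exp (\<mu> * h) *\<^sub>R ((1 / h) *\<^sub>R truncated h x))
      \<longlongrightarrow> \<mu> *\<^sub>R ?R - exp (\<mu> * 0) *\<^sub>R x) (at_right 0)"
    by (intro tendsto_diff tendsto_scaleR_locally_convex slope tendsto_const mean_tendsto)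
  moreover have "\<forall>\<^sub>F h in at_right 0.
      ((exp (\<mu> * h) - 1) / h) *\<^sub>R ?R - exp (\<mu> * h) *\<^sub>R ((1 / h) *\<^sub>R truncated h x) =
      (1 / h) *\<^sub>R (T h ?R - ?R)"
    using eventually_at_right_less[of "0::real"]
  proof eventually_elim
    case (elim h)
    have "exp (\<mu> * h) *\<^sub>R (?R - truncated h x) = exp (\<mu> * h) *\<^sub>R exp (- \<mu> * h) *\<^sub>R T h ?R"
      using laplace_split[OF elim, of x] by (metis add_diff_cancel_left')
    also have "\<dots> = T h ?R"
      by (simp flip: exp_add)
    finally have "T h ?R = exp (\<mu> * h) *\<^sub>R ?R - exp (\<mu> * h) *\<^sub>R truncated h x"
      by (simp add: scaleR_diff_right)
    then show ?case
      by (simp only:) (simp add: scaleR_diff_right scaleR_diff_left diff_divide_distrib)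
  qed
  ultimately show ?thesis
    by (auto intro: Lim_transform_eventually)
qed

lemma laplace_in_domain: "laplace_transform T \<mu> x \<in> generator_domain T"
  unfolding generator_domain_def using generator_quotient_laplace by blast

lemma generator_laplace:
  "generator T (laplace_transform T \<mu> x) = \<mu> *\<^sub>R laplace_transform T \<mu> x - x"
  unfolding generator_def by (intro tendsto_Lim generator_quotient_laplace) simp

subsection \<open>Sequential continuity and left inverse\<close>

text \<open>
  With right endpoints as tags, the weights of every equidistant sum of \<open>\<mu> * exp (- \<mu> * t)\<close> add up
  to at most one, so the sums lie in \<open>V\<close> itself, with no error term to be estimated.
\<close>

lemma laplace_mem_closure:
  assumes "convex V" "0 \<in> V" "\<And>t. t \<ge> 0 \<Longrightarrow> T t x \<in> V"
  shows "\<mu> *\<^sub>R laplace_transform T \<mu> x \<in> closure V"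
proof -
  have sums: "\<mu> *\<^sub>R equi_sum (\<lambda>t. exp (- \<mu> * t) *\<^sub>R T t x) 0 a n \<in> V" if "a > 0" for a n
  proof -
    define d where "d = a / Suc n"
    have d: "d > 0" using that by (simp add: d_def)
    have "\<mu> *\<^sub>R equi_sum (\<lambda>t. exp (- \<mu> * t) *\<^sub>R T t x) 0 a n =
        (\<Sum>i<Suc n. ((\<mu> * d) * exp (- (real (Suc i) * (\<mu> * d)))) *\<^sub>R T (real (Suc i) * d) x)"
      by (simp add: equi_sum_def d_def scaleR_sum_right mult_ac
          del: sum.lessThan_Suc of_nat_Suc)
    also have "\<dots> \<in> V"
      using assms d pos exp_right_sum_le[of "\<mu> * d" "Suc n"]
      by (intro convex_subcombination) (auto simp del: sum.lessThan_Suc)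
    finally show ?thesis .
  qed
  have "\<mu> *\<^sub>R truncated (real (Suc n)) x \<in> closure V" for n
  proof (rule limit_in_closure)
    show "(\<lambda>k. \<mu> *\<^sub>R equi_sum (\<lambda>t. exp (- \<mu> * t) *\<^sub>R T t x) 0 (real (Suc n)) k)
        \<longlonglongrightarrow> \<mu> *\<^sub>R truncated (real (Suc n)) x"
      by (intro tendsto_scaleR_locally_convex tendsto_const truncated_sums) simp
  qed (rule sums, simp)
  then have "\<mu> *\<^sub>R laplace_transform T \<mu> x \<in> closure (closure V)"
    by (intro limit_in_closure[OF tendsto_scaleR_locally_convex[OF tendsto_const
            truncated_seq_tendsto]])
  then show ?thesis by simp
qed

lemma laplace_seq_tendsto:
  assumes "u \<longlonglongrightarrow> x"
  shows "(\<lambda>n. laplace_transform T \<mu> (u n)) \<longlonglongrightarrow> laplace_transform T \<mu> x"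
proof -
  let ?R = "laplace_transform T \<mu>"
  have "(\<lambda>n. \<mu> *\<^sub>R ?R (u n - x)) \<longlonglongrightarrow> 0"
  proof (rule topological_tendstoI)
    fix U :: "'a set" assume "open U" "0 \<in> U"
    then obtain V where V: "open V" "convex V" "0 \<in> V" "closure V \<subseteq> U"
      using convex_neighbourhood_closure by blast
    from equicontinuous[OF assms V(1,3)]
    show "\<forall>\<^sub>F n in sequentially. \<mu> *\<^sub>R ?R (u n - x) \<in> U"
    proof eventually_elim
      case (elim n)
      then have "T t (u n - x) \<in> V" if "t \<ge> 0" for t
        using that by (simp add: linear_diff[OF linear_T])
      then show ?case
        using laplace_mem_closure[OF V(2,3)] V(4) by blast
    qed
  qed
  from tendsto_add[OF tendsto_scaleR_locally_convex[OF tendsto_const[of "1 / \<mu>"] this]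
      tendsto_const[of "?R x"]]
  show ?thesis using pos by (simp add: laplace_diff)
qed

lemma laplace_left_inverse:
  assumes "x \<in> generator_domain T"
  shows "laplace_transform T \<mu> (\<mu> *\<^sub>R x - generator T x) = x"
proof -
  let ?R = "laplace_transform T \<mu>"
  let ?q = "\<lambda>x h. (1 / h) *\<^sub>R (T h x - x)"
  obtain y where y: "(?q x \<longlongrightarrow> y) (at_right 0)"
    using assms unfolding generator_domain_def by blast
  have gen: "generator T x = y"
    unfolding generator_def using y by (intro tendsto_Lim) auto
  define h where "h n = inverse (real (Suc n))" for n
  have "h \<longlonglongrightarrow> 0"
    using LIMSEQ_inverse_real_of_nat by (simp add: h_def[abs_def])
  then have h: "filterlim h (at_right 0) sequentially"
    by (intro tendsto_imp_filterlim_at_right) (auto simp: h_def)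
  have "(\<lambda>n. ?R (?q x (h n))) \<longlonglongrightarrow> ?R y"
    by (intro laplace_seq_tendsto filterlim_compose[OF y h])
  moreover have "?R (?q x (h n)) = ?q (?R x) (h n)" for n
    by (simp only: laplace_scaleR laplace_diff, subst laplace_commutes) (auto simp: h_def)
  ultimately have "(\<lambda>n. ?q (?R x) (h n)) \<longlonglongrightarrow> ?R y" by simp
  then have "?R y = \<mu> *\<^sub>R ?R x - x"
    using LIMSEQ_unique filterlim_compose[OF generator_quotient_laplace h] by blast
  then show ?thesis
    by (simp add: gen laplace_diff laplace_scaleR)
qed

end

theorem theorem3p27:
  fixes T :: "real \<Rightarrow> 'a::locally_convex_t2 \<Rightarrow> 'a" and \<mu> :: real
  assumes "C0_seq_equicontinuous_semigroup T"
    and "\<And>x \<nu>. \<nu> > 0 \<Longrightarrow> gen_riemann_integrable (\<lambda>t. exp (- \<nu> * t) *\<^sub>R T t x)"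
    and "\<mu> > 0"
  shows "\<mu> \<in> resolvent_set\<^sub>0 (generator_domain T) (generator T) \<and>
    resolvent_op \<mu> (generator_domain T) (generator T) = laplace_transform T \<mu>"
proof -
  interpret laplace_semigroup T \<mu>
    using assms by unfold_locales auto
  let ?D = "generator_domain T" and ?R = "laplace_transform T \<mu>"
  let ?g = "\<lambda>x. \<mu> *\<^sub>R x - generator T x"
  have inj: "inj_on ?g ?D"
    by (rule inj_on_inverseI[of _ ?R]) (rule laplace_left_inverse)
  have right: "?g (?R y) = y" for y
    by (simp add: generator_laplace)
  have surj: "?g ` ?D = UNIV"
    using right[symmetric] laplace_in_domain by (blast intro: image_eqI)
  have op: "resolvent_op \<mu> ?D (generator T) = ?R"
    unfolding resolvent_op_def using the_inv_into_f_eq[OF inj right laplace_in_domain] by blast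
  have "seq_continuous_on UNIV ?R"
    unfolding seq_continuous_on_def using laplace_seq_tendsto by blast
  then have "\<mu> \<in> resolvent_set\<^sub>0 ?D (generator T)"
    unfolding resolvent_set\<^sub>0_def spectrum\<^sub>0_def using inj surj op by simp
  then show ?thesis using op by simp
qed

end
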